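(* Let $\Sigma_{\mathcal R}=(M,T,Fe)$ be a Riemannian mechanical system. Along every evolution curve $t\mapsto x(t)$ of $\Sigma_{\mathcal R}$, the variation of the kinetic energy $T$ is given by $$\frac{dT}{dt}=\frac12 F_i\,\frac{dx^i}{dt},$$ where $T$ and $F_i$ are evaluated at $\left(x(t),\frac{dx}{dt}(t)\right)$.
   Context: The summation convention is used and all objects are smooth. $M$ is a real $n$-dimensional smooth manifold; $(x^i,y^i)$ are the induced local coordinates on $TM$. A Riemannian mechanical system is a triple $\Sigma_{\mathcal R}=(M,T,Fe)$ where $T=\frac12 g_{ij}(x)y^iy^j$ (with $y^i=\frac{dx^i}{dt}$ along curves) is the kinetic energy of a given Riemannian space $(M,g_{ij}(x))$ and $Fe=F^i(x,y)\frac{\partial}{\partial y^i}$ is a given vertical vector field on $TM$ (external forces), with covariant components $F_i(x,y)=g_{ij}(x)F^j(x,y)$. The evolution curves of $\Sigma_{\mathcal R}$ are the curves $x(t)$ in $M$ satisfying the Lagrange equations $$\frac{d}{dt}\frac{\partial (2T)}{\partial y^i}-\frac{\partial (2T)}{\partial x^i}=F_i(x,y),\qquad y^i=\frac{dx^i}{dt}.$$ *)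

theory Defs
  imports "HOL-Analysis.Analysis"
begin

section \<open>Smooth maps between Euclidean spaces\<close>

text \<open>These are meant for an open set \<^term>\<open>S\<close> only: the derivatives are taken in the full
  neighbourhood of a point.\<close>

fun Ck_on :: "nat \<Rightarrow> 'a::euclidean_space set \<Rightarrow> ('a \<Rightarrow> 'b::euclidean_space) \<Rightarrow> bool" where
  "Ck_on 0 S f \<longleftrightarrow> continuous_on S f"
| "Ck_on (Suc k) S f \<longleftrightarrow> (\<forall>x\<in>S. f differentiable (at x)) \<and>
     (\<forall>v. Ck_on k S (\<lambda>x. frechet_derivative f (at x) v))"

definition smooth_on :: "'a::euclidean_space set \<Rightarrow> ('a \<Rightarrow> 'b::euclidean_space) \<Rightarrow> bool" where
  "smooth_on S f \<longleftrightarrow> (\<forall>k. Ck_on k S f)"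

section \<open>Smooth manifolds\<close>

text \<open>A chart is its domain together with its coordinate map, whose values outside the domain
  are irrelevant. The model space is any Euclidean space, so that the tangent bundle of a manifold
  modelled on \<open>'e\<close> can be given charts with values in \<open>'e \<times> 'e\<close>.\<close>

type_synonym ('m, 'e) chart = "'m set \<times> ('m \<Rightarrow> 'e)"

abbreviation chart_dom :: "('m, 'e) chart \<Rightarrow> 'm set" where
  "chart_dom c \<equiv> fst c"

abbreviation chart_map :: "('m, 'e) chart \<Rightarrow> 'm \<Rightarrow> 'e" where
  "chart_map c \<equiv> snd c"

definition chart_inv :: "('m, 'e) chart \<Rightarrow> 'e \<Rightarrow> 'm" where
  "chart_inv c = inv_into (chart_dom c) (chart_map c)"

definition transition :: "('m, 'e) chart \<Rightarrow> ('m, 'e) chart \<Rightarrow> 'e \<Rightarrow> 'e" where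
  "transition c d = chart_map d \<circ> chart_inv c"

text \<open>The atlas is not required to be maximal; a maximal one is a special case.\<close>

locale smooth_manifold =
  fixes M :: "'m topology"
    and A :: "('m, 'e::euclidean_space) chart set"
  assumes Hausdorff: "Hausdorff_space M"
    and second_countable: "second_countable M"
    and chart_dom_open: "c \<in> A \<Longrightarrow> openin M (chart_dom c)"
    and chart_image_open: "c \<in> A \<Longrightarrow> open (chart_map c ` chart_dom c)"
    and chart_homeomorphic: "c \<in> A \<Longrightarrow>
      homeomorphic_map (subtopology M (chart_dom c))
        (top_of_set (chart_map c ` chart_dom c)) (chart_map c)"
    and charts_cover: "(\<Union>c\<in>A. chart_dom c) = topspace M"
    and charts_compatible: "c \<in> A \<Longrightarrow> d \<in> A \<Longrightarrow>
      smooth_on (chart_map c ` (chart_dom c \<inter> chart_dom d)) (transition c d)"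

section \<open>Tangent vectors and the tangent bundle\<close>

text \<open>A tangent vector at \<open>p\<close> is the family of its component vectors in all the charts around
  \<open>p\<close>, subject to the transformation law of contravariant vectors. The components in the charts
  not around \<open>p\<close> are set to zero, so that a tangent vector is determined by its components in
  any one chart around \<open>p\<close>.\<close>

type_synonym ('m, 'e) tangent = "('m, 'e) chart \<Rightarrow> 'e"

definition tangent_space ::
    "('m, 'e::euclidean_space) chart set \<Rightarrow> 'm \<Rightarrow> ('m, 'e) tangent set" where
  "tangent_space A p = {v.
     (\<forall>c\<in>A. \<forall>d\<in>A. p \<in> chart_dom c \<inter> chart_dom d \<longrightarrow>
        v d = frechet_derivative (transition c d) (at (chart_map c p)) (v c)) \<and>
     (\<forall>c. \<not> (c \<in> A \<and> p \<in> chart_dom c) \<longrightarrow> v c = 0)}"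

text \<open>The tangent vector at \<open>p\<close> with components \<open>w\<close> in the chart \<open>c\<close>; for \<open>w = axis i 1\<close> it is
  the coordinate vector \<open>\<partial>/\<partial>x\<^sup>i\<close>.\<close>

definition tangent_of_components ::
    "('m, 'e::euclidean_space) chart set \<Rightarrow> ('m, 'e) chart \<Rightarrow> 'm \<Rightarrow> 'e \<Rightarrow> ('m, 'e) tangent" where
  "tangent_of_components A c p w = (\<lambda>d. if d \<in> A \<and> p \<in> chart_dom d
     then frechet_derivative (transition c d) (at (chart_map c p)) w else 0)"

text \<open>The induced coordinates \<open>(x\<^sup>i, y\<^sup>i)\<close> on the tangent bundle.\<close>

definition tangent_chart :: "('m, 'e::euclidean_space) chart set \<Rightarrow> ('m, 'e) chart \<Rightarrow>
    ('m \<times> ('m, 'e) tangent, 'e \<times> 'e) chart" where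
  "tangent_chart A c =
     (SIGMA p:chart_dom c. tangent_space A p, \<lambda>(p, v). (chart_map c p, v c))"

definition tangent_atlas :: "('m, 'e::euclidean_space) chart set \<Rightarrow>
    ('m \<times> ('m, 'e) tangent, 'e \<times> 'e) chart set" where
  "tangent_atlas A = tangent_chart A ` A"

section \<open>Vector fields\<close>

definition smooth_vector_field ::
    "('m, 'e::euclidean_space) chart set \<Rightarrow> ('m \<Rightarrow> ('m, 'e) tangent) \<Rightarrow> bool" where
  "smooth_vector_field A X \<longleftrightarrow>
     (\<forall>p\<in>(\<Union>c\<in>A. chart_dom c). X p \<in> tangent_space A p) \<and>
     (\<forall>c\<in>A. smooth_on (chart_map c ` chart_dom c) (\<lambda>z. X (chart_inv c z) c))"

text \<open>A vector field on the tangent bundle: its components in an induced chart \<open>(x, y)\<close> are a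
  pair \<open>(a, b)\<close> standing for \<open>a\<^sup>i \<partial>/\<partial>x\<^sup>i + b\<^sup>i \<partial>/\<partial>y\<^sup>i\<close>; it is vertical if \<open>a = 0\<close>.\<close>

type_synonym ('m, 'e) tangent_bundle_field =
  "'m \<times> ('m, 'e) tangent \<Rightarrow> ('m \<times> ('m, 'e) tangent, 'e \<times> 'e) tangent"

definition vertical_vector_field ::
    "('m, 'e::euclidean_space) chart set \<Rightarrow> ('m, 'e) tangent_bundle_field \<Rightarrow> bool" where
  "vertical_vector_field A Fe \<longleftrightarrow>
     smooth_vector_field (tangent_atlas A) Fe \<and>
     (\<forall>c\<in>A. \<forall>p\<in>chart_dom c. \<forall>v\<in>tangent_space A p. fst (Fe (p, v) (tangent_chart A c)) = 0)"

section \<open>Riemannian metrics\<close>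

definition metric_component :: "('m, real^'n) chart set \<Rightarrow>
    ('m \<Rightarrow> ('m, real^'n) tangent \<Rightarrow> ('m, real^'n) tangent \<Rightarrow> real) \<Rightarrow>
    ('m, real^'n) chart \<Rightarrow> 'n::finite \<Rightarrow> 'n \<Rightarrow> 'm \<Rightarrow> real" where
  "metric_component A g c i j p =
     g p (tangent_of_components A c p (axis i 1)) (tangent_of_components A c p (axis j 1))"

locale riemannian_manifold = smooth_manifold M A
  for M :: "'m topology"
    and A :: "('m, real^'n::finite) chart set" +
  fixes g :: "'m \<Rightarrow> ('m, real^'n) tangent \<Rightarrow> ('m, real^'n) tangent \<Rightarrow> real"
  assumes metric_linear: "p \<in> topspace M \<Longrightarrow> u \<in> tangent_space A p \<Longrightarrow> v \<in> tangent_space A p \<Longrightarrow>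
      w \<in> tangent_space A p \<Longrightarrow> g p (\<lambda>c. a *\<^sub>R u c + v c) w = a * g p u w + g p v w"
    and metric_symmetric: "p \<in> topspace M \<Longrightarrow> u \<in> tangent_space A p \<Longrightarrow>
      v \<in> tangent_space A p \<Longrightarrow> g p u v = g p v u"
    and metric_positive: "p \<in> topspace M \<Longrightarrow> v \<in> tangent_space A p \<Longrightarrow> v \<noteq> (\<lambda>c. 0) \<Longrightarrow>
      g p v v > 0"
    and metric_smooth: "c \<in> A \<Longrightarrow>
      smooth_on (chart_map c ` chart_dom c) (\<lambda>z. metric_component A g c i j (chart_inv c z))"

section \<open>Riemannian mechanical systems\<close>

text \<open>The kinetic energy \<open>T = 1/2 g\<^sub>i\<^sub>j(x) y\<^sup>i y\<^sup>j\<close> as a function on the tangent bundle; the coordinate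
  expression is \<open>kinetic_energy_coordinates\<close> below.\<close>

definition kinetic_energy ::
    "('m \<Rightarrow> ('m, 'e) tangent \<Rightarrow> ('m, 'e) tangent \<Rightarrow> real) \<Rightarrow> 'm \<times> ('m, 'e) tangent \<Rightarrow> real" where
  "kinetic_energy g = (\<lambda>(p, v). 1/2 * g p v v)"

locale riemannian_mechanical_system = riemannian_manifold M A g
  for M :: "'m topology"
    and A :: "('m, real^'n::finite) chart set"
    and g :: "'m \<Rightarrow> ('m, real^'n) tangent \<Rightarrow> ('m, real^'n) tangent \<Rightarrow> real" +
  fixes T :: "'m \<times> ('m, real^'n) tangent \<Rightarrow> real"
    and Fe :: "('m, real^'n) tangent_bundle_field"
  assumes T_eq: "T = kinetic_energy g"
    and Fe_vertical: "vertical_vector_field A Fe"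

definition force :: "('m, real^'n) chart set \<Rightarrow> ('m, real^'n) tangent_bundle_field \<Rightarrow>
    ('m, real^'n) chart \<Rightarrow> 'n::finite \<Rightarrow> 'm \<times> ('m, real^'n) tangent \<Rightarrow> real" where
  "force A Fe c i z = snd (Fe z (tangent_chart A c)) $ i"

definition covariant_force :: "('m, real^'n) chart set \<Rightarrow>
    ('m \<Rightarrow> ('m, real^'n) tangent \<Rightarrow> ('m, real^'n) tangent \<Rightarrow> real) \<Rightarrow>
    ('m, real^'n) tangent_bundle_field \<Rightarrow>
    ('m, real^'n) chart \<Rightarrow> 'n::finite \<Rightarrow> 'm \<times> ('m, real^'n) tangent \<Rightarrow> real" where
  "covariant_force A g Fe c i z = (\<Sum>j\<in>UNIV. metric_component A g c i j (fst z) * force A Fe c j z)"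

section \<open>Curves and the Lagrange equations\<close>

text \<open>Meant for an open interval \<open>J\<close>.\<close>

definition smooth_curve ::
    "'m topology \<Rightarrow> ('m, 'e::euclidean_space) chart set \<Rightarrow> real set \<Rightarrow> (real \<Rightarrow> 'm) \<Rightarrow> bool" where
  "smooth_curve M A J x \<longleftrightarrow> continuous_map (top_of_set J) M x \<and>
     (\<forall>c\<in>A. smooth_on {t\<in>J. x t \<in> chart_dom c} (chart_map c \<circ> x))"

definition velocity ::
    "('m, 'e::euclidean_space) chart set \<Rightarrow> (real \<Rightarrow> 'm) \<Rightarrow> real \<Rightarrow> ('m, 'e) tangent" where
  "velocity A x t = (\<lambda>c. if c \<in> A \<and> x t \<in> chart_dom c
     then vector_derivative (chart_map c \<circ> x) (at t) else 0)"

definition lift_curve :: "('m, 'e::euclidean_space) chart set \<Rightarrow> (real \<Rightarrow> 'm) \<Rightarrow>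
    real \<Rightarrow> 'm \<times> ('m, 'e) tangent" where
  "lift_curve A x t = (x t, velocity A x t)"

text \<open>Partial derivatives of a function on the tangent bundle in the induced coordinates
  \<open>(x\<^sup>i, y\<^sup>i)\<close> of a chart \<open>c\<close> of the base.\<close>

definition partial_x :: "('m, real^'n) chart set \<Rightarrow> ('m, real^'n) chart \<Rightarrow> 'n::finite \<Rightarrow>
    ('m \<times> ('m, real^'n) tangent \<Rightarrow> real) \<Rightarrow> 'm \<times> ('m, real^'n) tangent \<Rightarrow> real" where
  "partial_x A c i L z = deriv (\<lambda>h. L (chart_inv (tangent_chart A c)
     (chart_map (tangent_chart A c) z + h *\<^sub>R (axis i 1, 0)))) 0"

definition partial_y :: "('m, real^'n) chart set \<Rightarrow> ('m, real^'n) chart \<Rightarrow> 'n::finite \<Rightarrow>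
    ('m \<times> ('m, real^'n) tangent \<Rightarrow> real) \<Rightarrow> 'm \<times> ('m, real^'n) tangent \<Rightarrow> real" where
  "partial_y A c i L z = deriv (\<lambda>h. L (chart_inv (tangent_chart A c)
     (chart_map (tangent_chart A c) z + h *\<^sub>R (0, axis i 1)))) 0"

definition evolution_curve :: "'m topology \<Rightarrow> ('m, real^'n::finite) chart set \<Rightarrow>
    ('m \<Rightarrow> ('m, real^'n) tangent \<Rightarrow> ('m, real^'n) tangent \<Rightarrow> real) \<Rightarrow>
    ('m \<times> ('m, real^'n) tangent \<Rightarrow> real) \<Rightarrow> ('m, real^'n) tangent_bundle_field \<Rightarrow>
    real set \<Rightarrow> (real \<Rightarrow> 'm) \<Rightarrow> bool" where
  "evolution_curve M A g T Fe J x \<longleftrightarrow> smooth_curve M A J x \<and>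
     (\<forall>t\<in>J. \<forall>c\<in>A. x t \<in> chart_dom c \<longrightarrow> (\<forall>i.
        deriv (\<lambda>s. partial_y A c i (\<lambda>z. 2 * T z) (lift_curve A x s)) t
        - partial_x A c i (\<lambda>z. 2 * T z) (lift_curve A x t)
        = covariant_force A g Fe c i (lift_curve A x t)))"

section \<open>Coordinate expression of the kinetic energy\<close>

context smooth_manifold
begin

lemma chart_inj: "c \<in> A \<Longrightarrow> inj_on (chart_map c) (chart_dom c)"
  using chart_homeomorphic[of c] chart_dom_open[of c]
  by (auto simp: homeomorphic_map_def Int_absorb1 openin_subset topspace_subtopology
      dest!: homeomorphic_imp_injective_map)

lemma overlap_image_open:
  assumes "c \<in> A" "d \<in> A"
  shows "open (chart_map c ` (chart_dom c \<inter> chart_dom d))"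
proof -
  have "openin (subtopology M (chart_dom c)) (chart_dom c \<inter> chart_dom d)"
    using chart_dom_open[OF assms(2)] by (metis Int_commute openin_subtopology_Int)
  then have "openin (top_of_set (chart_map c ` chart_dom c))
      (chart_map c ` (chart_dom c \<inter> chart_dom d))"
    using homeomorphic_imp_open_map[OF chart_homeomorphic[OF assms(1)]]
    by (simp add: open_map_def)
  then show ?thesis
    using chart_image_open[OF assms(1)] openin_open_trans by blast
qed

lemma transition_differentiable:
  assumes "c \<in> A" "d \<in> A" "p \<in> chart_dom c" "p \<in> chart_dom d"
  shows "transition c d differentiable (at (chart_map c p))"
proof -
  have "Ck_on (Suc 0) (chart_map c ` (chart_dom c \<inter> chart_dom d)) (transition c d)"
    using charts_compatible[OF assms(1,2)] unfolding smooth_on_def by blast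
  then show ?thesis using assms by auto
qed

lemma chart_inv_apply: "c \<in> A \<Longrightarrow> p \<in> chart_dom c \<Longrightarrow> chart_inv c (chart_map c p) = p"
  unfolding chart_inv_def by (rule inv_into_f_f[OF chart_inj])

lemma transition_cocycle:
  assumes A: "c \<in> A" "d \<in> A" "e \<in> A"
    and p: "p \<in> chart_dom c" "p \<in> chart_dom d" "p \<in> chart_dom e"
  shows "frechet_derivative (transition c e) (at (chart_map c p)) w =
    frechet_derivative (transition d e) (at (chart_map d p))
      (frechet_derivative (transition c d) (at (chart_map c p)) w)"
proof -
  have p': "transition c d (chart_map c p) = chart_map d p"
    using chart_inv_apply[OF A(1) p(1)] by (simp add: transition_def)
  have d1: "(transition c d has_derivative frechet_derivative (transition c d) (at (chart_map c p)))
      (at (chart_map c p))"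
    using transition_differentiable[OF A(1,2) p(1,2)] by (simp add: frechet_derivative_works)
  have d2: "(transition d e has_derivative frechet_derivative (transition d e) (at (chart_map d p)))
      (at (transition c d (chart_map c p)))"
    using transition_differentiable[OF A(2,3) p(2,3)] by (simp add: frechet_derivative_works p')
  have "((transition d e \<circ> transition c d) has_derivative
      (frechet_derivative (transition d e) (at (chart_map d p)) \<circ>
       frechet_derivative (transition c d) (at (chart_map c p)))) (at (chart_map c p))"
    by (rule diff_chain_at[OF d1 d2])
  then have "(transition c e has_derivative
      (frechet_derivative (transition d e) (at (chart_map d p)) \<circ>
       frechet_derivative (transition c d) (at (chart_map c p)))) (at (chart_map c p))"
  proof (rule has_derivative_transform_within_open)
    show "open (chart_map c ` (chart_dom c \<inter> chart_dom d))"
      by (rule overlap_image_open[OF A(1,2)])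
    show "chart_map c p \<in> chart_map c ` (chart_dom c \<inter> chart_dom d)"
      using p by auto
    show "(transition d e \<circ> transition c d) z = transition c e z"
      if "z \<in> chart_map c ` (chart_dom c \<inter> chart_dom d)" for z
      using that A by (auto simp: transition_def chart_inv_apply)
  qed
  then show ?thesis
    by (metis comp_apply frechet_derivative_at)
qed

lemma tangent_of_components_in:
  assumes "c \<in> A" "p \<in> chart_dom c"
  shows "tangent_of_components A c p w \<in> tangent_space A p"
  using assms by (auto simp: tangent_space_def tangent_of_components_def intro!: transition_cocycle)

lemma zero_in_tangent_space: "(\<lambda>c. 0) \<in> tangent_space A p"
proof -
  have "frechet_derivative (transition c d) (at (chart_map c p)) 0 = 0"
    if "c \<in> A" "d \<in> A" "p \<in> chart_dom c" "p \<in> chart_dom d" for c d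
    using linear_frechet_derivative[OF transition_differentiable[OF that]] by (rule linear_0)
  then show ?thesis by (auto simp: tangent_space_def)
qed

lemma tangent_transform:
  assumes "v \<in> tangent_space A p" "c \<in> A" "d \<in> A" "p \<in> chart_dom c" "p \<in> chart_dom d"
  shows "v d = frechet_derivative (transition c d) (at (chart_map c p)) (v c)"
  using assms unfolding tangent_space_def by blast

lemma tangent_zero:
  assumes "v \<in> tangent_space A p" "\<not> (c \<in> A \<and> p \<in> chart_dom c)"
  shows "v c = 0"
  using assms unfolding tangent_space_def by blast

lemma combination_in_tangent_space:
  assumes u: "u \<in> tangent_space A p" and v: "v \<in> tangent_space A p"
  shows "(\<lambda>c. a *\<^sub>R u c + v c) \<in> tangent_space A p"
proof -
  have "a *\<^sub>R u d + v d =
      frechet_derivative (transition c d) (at (chart_map c p)) (a *\<^sub>R u c + v c)"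
    if "c \<in> A" "d \<in> A" "p \<in> chart_dom c" "p \<in> chart_dom d" for c d
    unfolding linear_add[OF linear_frechet_derivative[OF transition_differentiable[OF that]]]
      linear_scale[OF linear_frechet_derivative[OF transition_differentiable[OF that]]]
    by (intro arg_cong2[where f = "(+)"] arg_cong[where f = "\<lambda>x. a *\<^sub>R x"]
        tangent_transform[OF u that] tangent_transform[OF v that])
  moreover have "a *\<^sub>R u c + v c = 0" if "\<not> (c \<in> A \<and> p \<in> chart_dom c)" for c
    using tangent_zero[OF u that] tangent_zero[OF v that] by simp
  ultimately show ?thesis
    unfolding tangent_space_def by blast
qed

end

context riemannian_manifold
begin

lemma metric_sum:
  assumes p: "p \<in> topspace M" and w: "w \<in> tangent_space A p"
    and u: "\<And>i. u i \<in> tangent_space A p" and "finite I"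
  shows "(\<lambda>c. \<Sum>i\<in>I. a i *\<^sub>R u i c) \<in> tangent_space A p \<and>
    g p (\<lambda>c. \<Sum>i\<in>I. a i *\<^sub>R u i c) w = (\<Sum>i\<in>I. a i * g p (u i) w)"
  using \<open>finite I\<close>
proof (induction I rule: finite_induct)
  case empty
  have "g p (\<lambda>c. 0) w = 0"
    using metric_linear[OF p zero_in_tangent_space zero_in_tangent_space w, of 1] by simp
  then show ?case using zero_in_tangent_space by simp
next
  case (insert i I)
  define s where "s = (\<lambda>c. \<Sum>i\<in>I. a i *\<^sub>R u i c)"
  have s: "s \<in> tangent_space A p" and gs: "g p s w = (\<Sum>i\<in>I. a i * g p (u i) w)"
    using insert.IH by (simp_all add: s_def)
  have "(\<lambda>c. \<Sum>i\<in>insert i I. a i *\<^sub>R u i c) = (\<lambda>c. a i *\<^sub>R u i c + s c)"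
    using insert.hyps by (simp add: s_def)
  then show ?case
    using metric_linear[OF p u s w] combination_in_tangent_space[OF u s] gs insert.hyps
    by simp
qed

lemma kinetic_energy_coordinates:
  assumes c: "c \<in> A" "p \<in> chart_dom c" and v: "v \<in> tangent_space A p"
  shows "kinetic_energy g (p, v) =
    1/2 * (\<Sum>i\<in>UNIV. \<Sum>j\<in>UNIV. metric_component A g c i j p * v c $ i * v c $ j)"
proof -
  let ?e = "\<lambda>i. tangent_of_components A c p (axis i 1)"
  have p: "p \<in> topspace M"
    using c charts_cover by auto
  have e: "?e i \<in> tangent_space A p" for i
    by (rule tangent_of_components_in[OF c])
  have "v d = (\<Sum>i\<in>UNIV. (v c $ i) *\<^sub>R ?e i d)" for d
  proof (cases "d \<in> A \<and> p \<in> chart_dom d")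
    case True
    let ?D = "frechet_derivative (transition c d) (at (chart_map c p))"
    have lin: "linear ?D"
      using linear_frechet_derivative[OF transition_differentiable] c True by blast
    have "v d = ?D (v c)"
      using tangent_transform[OF v] c True by blast
    also have "\<dots> = ?D (\<Sum>i\<in>UNIV. (v c $ i) *\<^sub>R axis i 1)"
      by (simp add: basis_expansion flip: scalar_mult_eq_scaleR)
    also have "\<dots> = (\<Sum>i\<in>UNIV. (v c $ i) *\<^sub>R ?D (axis i 1))"
      by (simp add: linear_sum[OF lin] linear_scale[OF lin])
    finally show ?thesis using True by (simp add: tangent_of_components_def)
  next
    case False
    then show ?thesis using tangent_zero[OF v False] by (auto simp: tangent_of_components_def)
  qed
  then have v_eq: "v = (\<lambda>d. \<Sum>i\<in>UNIV. (v c $ i) *\<^sub>R ?e i d)"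
    by blast
  have expand: "g p v w = (\<Sum>i\<in>UNIV. v c $ i * g p (?e i) w)" if "w \<in> tangent_space A p" for w
  proof -
    have "g p v w = g p (\<lambda>d. \<Sum>i\<in>UNIV. (v c $ i) *\<^sub>R ?e i d) w"
      by (rule arg_cong[OF v_eq, of "\<lambda>u. g p u w"])
    also have "\<dots> = (\<Sum>i\<in>UNIV. v c $ i * g p (?e i) w)"
      by (rule conjunct2[OF metric_sum[OF p that e finite]])
    finally show ?thesis .
  qed
  have "g p (?e i) v = (\<Sum>j\<in>UNIV. v c $ j * metric_component A g c i j p)" for i
    unfolding metric_symmetric[OF p e v, of i] expand[OF e, of i] metric_component_def
    by (intro sum.cong refl arg_cong2[where f = "(*)"] metric_symmetric[OF p e e])
  then show ?thesis
    by (simp add: kinetic_energy_def expand[OF v] sum_distrib_left mult_ac)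
qed

end

end

theory Submission
  imports Defs
begin

text \<open>The Lagrangian \<open>L = 2 T = g\<^sub>i\<^sub>j y\<^sup>i y\<^sup>j\<close> is homogeneous of degree two in the velocities, so that by
  Euler's theorem its energy \<open>y\<^sup>i \<partial>L/\<partial>y\<^sup>i - L\<close> is \<open>L\<close> again. Contracting the Lagrange equations
  with \<open>y\<^sup>i\<close> therefore gives \<open>dL/dt = F\<^sub>i y\<^sup>i\<close>, that is \<open>dT/dt = 1/2 F\<^sub>i y\<^sup>i\<close>.

  In a chart this is a computation with the quadratic form \<open>metric_form\<close>. All the derivatives that
  it needs, the two partial ones in the Lagrange equations and the one along the curve, are
  instances of a single chain rule, \<open>metric_form_derivative\<close>; the contraction itself is
  \<open>lagrange_contraction\<close>. The geometric part has to justify the passage to the chart: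
  the lift of the curve lies in the tangent bundle (\<open>velocity_in_tangent_space\<close>), and the inverse of
  an induced chart maps \<open>(z, w)\<close> to the tangent vector at \<open>z\<close> with components \<open>w\<close>
  (\<open>tangent_chart_inv\<close>), so that the Lagrangian read in this chart is the quadratic form.\<close>

section \<open>Quadratic forms with variable coefficients\<close>

definition metric_form :: "('n::finite \<Rightarrow> 'n \<Rightarrow> 'e \<Rightarrow> real) \<Rightarrow> 'e \<Rightarrow> real^'n \<Rightarrow> real" where
  "metric_form G z w = (\<Sum>i\<in>UNIV. \<Sum>j\<in>UNIV. G i j z * w $ i * w $ j)"

lemma has_real_derivative_along:
  fixes f :: "'e::real_normed_vector \<Rightarrow> real"
  assumes "(z has_vector_derivative z') (at t)" and "(f has_derivative f') (at (z t))"
  shows "((\<lambda>h. f (z h)) has_real_derivative f' z') (at t)"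
proof -
  have lin: "linear f'"
    using assms(2) by (rule has_derivative_linear)
  have "((\<lambda>h. f (z h)) has_derivative (\<lambda>h. f' (h *\<^sub>R z'))) (at t)"
    using has_derivative_compose[OF assms(1)[unfolded has_vector_derivative_def] assms(2)] .
  moreover have "(\<lambda>h. f' (h *\<^sub>R z')) = (*) (f' z')"
    by (simp add: linear_scale[OF lin] fun_eq_iff)
  ultimately show ?thesis
    by (simp add: has_field_derivative_def)
qed

lemma has_real_derivative_component:
  fixes w :: "real \<Rightarrow> real^'n::finite"
  assumes "(w has_vector_derivative w') (at t)"
  shows "((\<lambda>h. w h $ i) has_real_derivative w' $ i) (at t)"
  using assms bounded_linear_imp_has_derivative[OF bounded_linear_vec_nth]
  by (rule has_real_derivative_along[where f = "\<lambda>v. v $ i" and f' = "\<lambda>v. v $ i"])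

text \<open>By symmetry of the coefficients, the two places of the velocity contribute the same amount.
  Varying \<open>z\<close> or \<open>w\<close> alone gives the partial derivatives of the form.\<close>

lemma metric_form_derivative:
  fixes G :: "'n::finite \<Rightarrow> 'n \<Rightarrow> 'e::real_normed_vector \<Rightarrow> real" and w :: "real \<Rightarrow> real^'n"
  assumes z: "(z has_vector_derivative z') (at t)"
    and w: "(w has_vector_derivative w') (at t)"
    and G: "\<And>i j. (G i j has_derivative G' i j) (at (z t))"
    and sym: "\<And>i j. G i j (z t) = G j i (z t)"
  shows "((\<lambda>h. metric_form G (z h) (w h)) has_real_derivative
    (\<Sum>i\<in>UNIV. \<Sum>j\<in>UNIV. G' i j z' * w t $ i * w t $ j)
    + 2 * (\<Sum>i\<in>UNIV. \<Sum>j\<in>UNIV. G i j (z t) * w' $ i * w t $ j)) (at t)"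
proof -
  have "((\<lambda>h. metric_form G (z h) (w h)) has_real_derivative
    (\<Sum>i\<in>UNIV. \<Sum>j\<in>UNIV. (G' i j z' * w t $ i + w' $ i * G i j (z t)) * w t $ j
       + w' $ j * (G i j (z t) * w t $ i))) (at t)"
    unfolding metric_form_def
    by (intro DERIV_sum DERIV_mult has_real_derivative_along[OF z G]
        has_real_derivative_component[OF w])
  moreover have "(\<Sum>i\<in>UNIV. \<Sum>j\<in>UNIV. w' $ j * (G i j (z t) * w t $ i))
    = (\<Sum>i\<in>UNIV. \<Sum>j\<in>UNIV. G i j (z t) * w' $ i * w t $ j)"
    by (subst sum.swap) (simp add: sym mult_ac)
  ultimately show ?thesis
    by (simp add: sum.distrib algebra_simps)
qed

lemma sum_axis_left:
  fixes f :: "'n::finite \<Rightarrow> real"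
  shows "(\<Sum>k\<in>UNIV. axis i 1 $ k * f k) = f i"
  by (simp add: axis_def if_distrib[of "\<lambda>x. x * _"] cong: if_cong)

lemma metric_form_partial_velocity:
  fixes G :: "'n::finite \<Rightarrow> 'n \<Rightarrow> 'e::real_normed_vector \<Rightarrow> real"
  assumes G: "\<And>i j. (G i j has_derivative G' i j) (at z)"
    and sym: "\<And>i j. G i j z = G j i z"
  shows "((\<lambda>h. metric_form G z (w + h *\<^sub>R axis i 1)) has_real_derivative
    2 * (\<Sum>j\<in>UNIV. G i j z * w $ j)) (at 0)"
proof -
  have zero: "G' i j 0 = 0" for i j
    using has_derivative_linear[OF G] by (rule linear_0)
  have line: "((\<lambda>h. w + h *\<^sub>R axis i 1) has_vector_derivative axis i 1) (at (0::real))"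
    by (auto intro!: derivative_eq_intros)
  have "(\<Sum>k\<in>UNIV. \<Sum>j\<in>UNIV. G k j z * axis i 1 $ k * w $ j)
      = (\<Sum>k\<in>UNIV. axis i 1 $ k * (\<Sum>j\<in>UNIV. G k j z * w $ j))"
    by (simp add: sum_distrib_left mult_ac)
  then show ?thesis
    using metric_form_derivative[where z = "\<lambda>_. z" and G = G and G' = G',
        OF has_vector_derivative_const line G sym]
    by (simp add: zero sum_axis_left)
qed

lemma metric_form_partial_position:
  fixes G :: "'n::finite \<Rightarrow> 'n \<Rightarrow> 'e::real_normed_vector \<Rightarrow> real"
  assumes G: "\<And>i j. (G i j has_derivative G' i j) (at z)"
    and sym: "\<And>i j. G i j z = G j i z"
  shows "((\<lambda>h. metric_form G (z + h *\<^sub>R e) w) has_real_derivative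
    (\<Sum>i\<in>UNIV. \<Sum>j\<in>UNIV. G' i j e * w $ i * w $ j)) (at 0)"
proof -
  have line: "((\<lambda>h. z + h *\<^sub>R e) has_vector_derivative e) (at (0::real))"
    by (auto intro!: derivative_eq_intros)
  show ?thesis
    using metric_form_derivative[where w = "\<lambda>_. w", OF line has_vector_derivative_const, of G G']
      G sym by simp
qed

lemma linear_on_coordinates:
  fixes f :: "real^'n::finite \<Rightarrow> real"
  assumes "linear f"
  shows "f w = (\<Sum>i\<in>UNIV. w $ i * f (axis i 1))"
proof -
  have "f w = f (\<Sum>i\<in>UNIV. (w $ i) *\<^sub>R axis i 1)"
    by (simp add: basis_expansion flip: scalar_mult_eq_scaleR)
  then show ?thesis
    by (simp add: linear_sum[OF assms] linear_scale[OF assms])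
qed

text \<open>The contraction of the left side of the Lagrange equations with the velocity \<open>w\<close>, where \<open>a\<close>
  is the acceleration and \<open>D i j\<close> the differential of the coefficient \<open>g\<^sub>i\<^sub>j\<close>. The position
  derivatives in it add up to \<open>D i j w\<close>, which cancels one of the two copies of this term that come
  from differentiating the momenta; what is left is the derivative of the form along the curve.\<close>

lemma lagrange_contraction:
  fixes w a :: "real^'n::finite" and D :: "'n \<Rightarrow> 'n \<Rightarrow> real^'n \<Rightarrow> real"
  assumes lin: "\<And>i j. linear (D i j)" and sym: "\<And>i j. \<gamma> i j = \<gamma> j i"
  shows "(\<Sum>k\<in>UNIV. (2 * (\<Sum>j\<in>UNIV. D k j w * w $ j + \<gamma> k j * a $ j)
      - (\<Sum>i\<in>UNIV. \<Sum>j\<in>UNIV. D i j (axis k 1) * w $ i * w $ j)) * w $ k)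
    = (\<Sum>i\<in>UNIV. \<Sum>j\<in>UNIV. D i j w * w $ i * w $ j)
      + 2 * (\<Sum>i\<in>UNIV. \<Sum>j\<in>UNIV. \<gamma> i j * a $ i * w $ j)"
proof -
  have position: "(\<Sum>k\<in>UNIV. \<Sum>i\<in>UNIV. \<Sum>j\<in>UNIV. w $ k * (D i j (axis k 1) * w $ i * w $ j))
      = (\<Sum>i\<in>UNIV. \<Sum>j\<in>UNIV. D i j w * w $ i * w $ j)"
  proof -
    have "(\<Sum>k\<in>UNIV. \<Sum>i\<in>UNIV. \<Sum>j\<in>UNIV. w $ k * (D i j (axis k 1) * w $ i * w $ j))
        = (\<Sum>i\<in>UNIV. \<Sum>k\<in>UNIV. \<Sum>j\<in>UNIV. w $ k * (D i j (axis k 1) * w $ i * w $ j))"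
      by (rule sum.swap)
    also have "\<dots> = (\<Sum>i\<in>UNIV. \<Sum>j\<in>UNIV. \<Sum>k\<in>UNIV. w $ k * (D i j (axis k 1) * w $ i * w $ j))"
      by (intro sum.cong refl sum.swap)
    also have "\<dots> = (\<Sum>i\<in>UNIV. \<Sum>j\<in>UNIV. D i j w * w $ i * w $ j)"
      unfolding linear_on_coordinates[OF lin, of _ _ w]
      by (simp add: sum_distrib_left sum_distrib_right mult_ac)
    finally show ?thesis .
  qed
  have acceleration: "(\<Sum>k\<in>UNIV. \<Sum>j\<in>UNIV. w $ k * (\<gamma> k j * a $ j))
      = (\<Sum>i\<in>UNIV. \<Sum>j\<in>UNIV. \<gamma> i j * a $ i * w $ j)"
    by (subst sum.swap) (simp add: sym mult_ac)
  have "(\<Sum>k\<in>UNIV. (2 * (\<Sum>j\<in>UNIV. D k j w * w $ j + \<gamma> k j * a $ j)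
      - (\<Sum>i\<in>UNIV. \<Sum>j\<in>UNIV. D i j (axis k 1) * w $ i * w $ j)) * w $ k)
    = 2 * (\<Sum>k\<in>UNIV. \<Sum>j\<in>UNIV. D k j w * w $ k * w $ j)
      + 2 * (\<Sum>k\<in>UNIV. \<Sum>j\<in>UNIV. w $ k * (\<gamma> k j * a $ j))
      - (\<Sum>k\<in>UNIV. \<Sum>i\<in>UNIV. \<Sum>j\<in>UNIV. w $ k * (D i j (axis k 1) * w $ i * w $ j))"
    by (simp add: sum.distrib sum_subtractf left_diff_distrib right_diff_distrib distrib_left
        distrib_right sum_distrib_left sum_distrib_right mult_ac)
  then show ?thesis
    by (simp add: position acceleration)
qed

section \<open>Curves and their lifts in induced charts\<close>

lemma smooth_on_differentiable:
  assumes "smooth_on S f" "s \<in> S"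
  shows "f differentiable (at s)"
proof -
  have "Ck_on (Suc 0) S f"
    using assms(1) unfolding smooth_on_def by blast
  then show ?thesis
    using assms(2) by simp
qed

text \<open>This provides the acceleration of a curve in a chart: for a function of one real variable, the
  directional derivative in the direction \<open>1\<close>, which the definition of smoothness speaks of, is the
  vector derivative.\<close>

lemma smooth_on_vector_derivative_differentiable:
  fixes f :: "real \<Rightarrow> 'b::euclidean_space"
  assumes f: "smooth_on S f" and S: "open S" "s \<in> S"
  shows "(\<lambda>r. vector_derivative f (at r)) differentiable (at s)"
proof -
  have "Ck_on (Suc (Suc 0)) S f"
    using f unfolding smooth_on_def by blast
  then have "(\<lambda>r. frechet_derivative f (at r) 1) differentiable (at s)"
    using S(2) by simp
  then obtain D where D: "((\<lambda>r. frechet_derivative f (at r) 1) has_derivative D) (at s)"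
    unfolding differentiable_def by blast
  have "frechet_derivative f (at r) 1 = vector_derivative f (at r)" if "r \<in> S" for r
    using smooth_on_differentiable[OF f that]
    by (simp add: frechet_derivative_eq_vector_derivative)
  then have "((\<lambda>r. vector_derivative f (at r)) has_derivative D) (at s)"
    by (rule has_derivative_transform_within_open[OF D S])
  then show ?thesis
    unfolding differentiable_def by blast
qed

context smooth_manifold
begin

lemma tangent_of_components_same_chart:
  assumes c: "c \<in> A" "p \<in> chart_dom c"
  shows "tangent_of_components A c p w c = w"
proof -
  have "(transition c c has_derivative (\<lambda>v. v)) (at (chart_map c p))"
    by (rule has_derivative_transform_within_open[OF has_derivative_ident chart_image_open[OF c(1)]])
      (use c in \<open>auto simp: transition_def chart_inv_apply\<close>)
  then have "frechet_derivative (transition c c) (at (chart_map c p)) = (\<lambda>v. v)"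
    by (rule frechet_derivative_at[symmetric])
  then show ?thesis
    using c by (simp add: tangent_of_components_def)
qed

text \<open>The transformation law fixes the components in the other charts around \<open>p\<close>, and all the
  remaining ones vanish by convention.\<close>

lemma tangent_determined_by_components:
  assumes "u \<in> tangent_space A p" "v \<in> tangent_space A p"
    and "c \<in> A" "p \<in> chart_dom c" "u c = v c"
  shows "u = v"
proof
  fix d
  show "u d = v d"
    using tangent_transform[OF assms(1,3), of d] tangent_transform[OF assms(2,3), of d]
      tangent_zero[OF assms(1), of d] tangent_zero[OF assms(2), of d] assms(4,5)
    by (cases "d \<in> A \<and> p \<in> chart_dom d") auto
qed

lemma tangent_chart_inj:
  assumes "c \<in> A"
  shows "inj_on (chart_map (tangent_chart A c)) (chart_dom (tangent_chart A c))"
proof (rule inj_onI, clarify)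
  fix p u q v
  assume pu: "(p, u) \<in> chart_dom (tangent_chart A c)"
    and qv: "(q, v) \<in> chart_dom (tangent_chart A c)"
    and "chart_map (tangent_chart A c) (p, u) = chart_map (tangent_chart A c) (q, v)"
  then have "chart_map c p = chart_map c q" and uv: "u c = v c"
    by (simp_all add: tangent_chart_def)
  then have "p = q"
    using inj_onD[OF chart_inj[OF assms]] pu qv by (simp add: tangent_chart_def)
  with pu qv have "u \<in> tangent_space A p" "v \<in> tangent_space A p" "p \<in> chart_dom c"
    by (simp_all add: tangent_chart_def)
  then show "p = q \<and> u = v"
    using \<open>p = q\<close> tangent_determined_by_components assms uv by blast
qed

lemma tangent_chart_inv:
  assumes c: "c \<in> A" and z: "z \<in> chart_map c ` chart_dom c"
  shows "chart_inv (tangent_chart A c) (z, w) =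
    (chart_inv c z, tangent_of_components A c (chart_inv c z) w)"
proof -
  obtain p where p: "p \<in> chart_dom c" "z = chart_map c p"
    using z by blast
  have "chart_inv (tangent_chart A c) (z, w) = (p, tangent_of_components A c p w)"
    unfolding chart_inv_def
    by (rule inv_into_f_eq[OF tangent_chart_inj[OF c]])
      (use c p in \<open>auto simp: tangent_chart_def tangent_of_components_in
          tangent_of_components_same_chart\<close>)
  then show ?thesis
    using c p by (simp add: chart_inv_apply)
qed

lemma open_curve_in_chart:
  assumes "smooth_curve M A J x" "open J" "c \<in> A"
  shows "open {t \<in> J. x t \<in> chart_dom c}"
proof -
  have "openin (top_of_set J) {t \<in> topspace (top_of_set J). x t \<in> chart_dom c}"
    using assms(1) chart_dom_open[OF assms(3)] unfolding smooth_curve_def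
    by (blast intro: openin_continuous_map_preimage)
  then show ?thesis
    using openin_open_trans[OF _ assms(2)] by simp
qed

lemma curve_has_velocity:
  assumes x: "smooth_curve M A J x" and t: "t \<in> J" and c: "c \<in> A" "x t \<in> chart_dom c"
  shows "((chart_map c \<circ> x) has_vector_derivative velocity A x t c) (at t)"
proof -
  have "(chart_map c \<circ> x) differentiable (at t)"
    using x t c by (intro smooth_on_differentiable[of "{t \<in> J. x t \<in> chart_dom c}"])
      (auto simp: smooth_curve_def)
  then show ?thesis
    using c by (simp add: velocity_def vector_derivative_works)
qed

text \<open>The transformation law is the chain rule for \<open>chart_map d \<circ> x\<close>, which near \<open>t\<close> is the
  transition map applied to \<open>chart_map c \<circ> x\<close>.\<close>

lemma velocity_in_tangent_space:
  assumes x: "smooth_curve M A J x" and J: "open J" "t \<in> J"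
  shows "velocity A x t \<in> tangent_space A (x t)"
proof -
  have "velocity A x t d =
      frechet_derivative (transition c d) (at (chart_map c (x t))) (velocity A x t c)"
    if A: "c \<in> A" "d \<in> A" and xt: "x t \<in> chart_dom c" "x t \<in> chart_dom d" for c d
  proof -
    let ?D = "frechet_derivative (transition c d) (at (chart_map c (x t)))"
    have "(transition c d has_derivative ?D) (at ((chart_map c \<circ> x) t))"
      using transition_differentiable[OF A xt] by (simp add: frechet_derivative_works)
    from vector_derivative_diff_chain_within
      [OF curve_has_velocity[OF x J(2) A(1) xt(1)] has_derivative_at_withinI[OF this]]
    have "((transition c d \<circ> (chart_map c \<circ> x)) has_vector_derivative ?D (velocity A x t c)) (at t)"
      .
    then have "((chart_map d \<circ> x) has_vector_derivative ?D (velocity A x t c)) (at t)"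
    proof (rule has_vector_derivative_transform_within_open)
      show "open ({s \<in> J. x s \<in> chart_dom c} \<inter> {s \<in> J. x s \<in> chart_dom d})"
        using open_curve_in_chart[OF x J(1)] A by blast
      show "t \<in> {s \<in> J. x s \<in> chart_dom c} \<inter> {s \<in> J. x s \<in> chart_dom d}"
        using J xt by blast
      show "(transition c d \<circ> (chart_map c \<circ> x)) s = (chart_map d \<circ> x) s"
        if "s \<in> {s \<in> J. x s \<in> chart_dom c} \<inter> {s \<in> J. x s \<in> chart_dom d}" for s
        using that A by (simp add: transition_def chart_inv_apply)
    qed
    then show ?thesis
      using curve_has_velocity[OF x J(2) A(2) xt(2)] vector_derivative_unique_at by blast
  qed
  moreover have "velocity A x t c = 0" if "\<not> (c \<in> A \<and> x t \<in> chart_dom c)" for c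
    using that unfolding velocity_def by (rule if_not_P)
  ultimately show ?thesis
    unfolding tangent_space_def by blast
qed

end

section \<open>The kinetic energy in induced charts\<close>

context riemannian_manifold
begin

abbreviation coefficients :: "('m, real^'n) chart \<Rightarrow> 'n \<Rightarrow> 'n \<Rightarrow> real^'n \<Rightarrow> real" where
  "coefficients c i j z \<equiv> metric_component A g c i j (chart_inv c z)"

abbreviation coefficient_derivative ::
    "('m, real^'n) chart \<Rightarrow> real^'n \<Rightarrow> 'n \<Rightarrow> 'n \<Rightarrow> real^'n \<Rightarrow> real" where
  "coefficient_derivative c z i j \<equiv> frechet_derivative (coefficients c i j) (at z)"

lemma coefficients_derivative:
  assumes "c \<in> A" "z \<in> chart_map c ` chart_dom c"
  shows "(coefficients c i j has_derivative coefficient_derivative c z i j) (at z)"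
  using smooth_on_differentiable[OF metric_smooth[OF assms(1)] assms(2)]
  by (simp add: frechet_derivative_works)

lemma coefficients_symmetric:
  assumes "c \<in> A" "z \<in> chart_map c ` chart_dom c"
  shows "coefficients c i j z = coefficients c j i z"
proof -
  have p: "chart_inv c z \<in> chart_dom c"
    using assms by (auto simp: chart_inv_apply)
  then have "chart_inv c z \<in> topspace M"
    using assms(1) charts_cover by blast
  then show ?thesis
    unfolding metric_component_def
    using metric_symmetric tangent_of_components_in[OF assms(1) p] by blast
qed

lemma kinetic_energy_in_chart:
  assumes "c \<in> A" "p \<in> chart_dom c" "v \<in> tangent_space A p"
  shows "2 * kinetic_energy g (p, v) = metric_form (coefficients c) (chart_map c p) (v c)"
  using kinetic_energy_coordinates[OF assms] assms
  by (simp add: metric_form_def chart_inv_apply)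

lemma kinetic_energy_tangent_chart_inv:
  assumes c: "c \<in> A" and z: "z \<in> chart_map c ` chart_dom c"
  shows "2 * kinetic_energy g (chart_inv (tangent_chart A c) (z, w))
    = metric_form (coefficients c) z w"
proof -
  obtain p where p: "p \<in> chart_dom c" "z = chart_map c p"
    using z by blast
  show ?thesis
    unfolding tangent_chart_inv[OF c z]
    using kinetic_energy_in_chart[OF c p(1) tangent_of_components_in[OF c p(1)], of w]
    by (simp add: p chart_inv_apply[OF c] tangent_of_components_same_chart[OF c])
qed

lemma partial_y_kinetic_energy:
  assumes c: "c \<in> A" "p \<in> chart_dom c"
  shows "partial_y A c i (\<lambda>z. 2 * kinetic_energy g z) (p, v)
    = 2 * (\<Sum>j\<in>UNIV. coefficients c i j (chart_map c p) * v c $ j)"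
proof -
  have z: "chart_map c p \<in> chart_map c ` chart_dom c"
    using c by blast
  have "partial_y A c i (\<lambda>z. 2 * kinetic_energy g z) (p, v)
      = deriv (\<lambda>h. metric_form (coefficients c) (chart_map c p) (v c + h *\<^sub>R axis i 1)) 0"
    by (simp add: partial_y_def kinetic_energy_tangent_chart_inv[OF c(1) z]
        tangent_chart_def[of A c, THEN arg_cong[of _ _ snd]])
  also have "\<dots> = 2 * (\<Sum>j\<in>UNIV. coefficients c i j (chart_map c p) * v c $ j)"
    by (rule DERIV_imp_deriv[OF metric_form_partial_velocity[OF coefficients_derivative[OF c(1) z]
            coefficients_symmetric[OF c(1) z]]])
  finally show ?thesis .
qed

lemma partial_x_kinetic_energy:
  assumes c: "c \<in> A" "p \<in> chart_dom c"
  shows "partial_x A c i (\<lambda>z. 2 * kinetic_energy g z) (p, v)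
    = (\<Sum>k\<in>UNIV. \<Sum>j\<in>UNIV.
        coefficient_derivative c (chart_map c p) k j (axis i 1) * v c $ k * v c $ j)"
proof -
  let ?U = "chart_map c ` chart_dom c" and ?z = "chart_map c p"
  let ?line = "\<lambda>h::real. ?z + h *\<^sub>R axis i 1"
  have z: "?z \<in> ?U"
    using c by blast
  \<comment> \<open>The Lagrangian is the quadratic form only as long as the line stays in the chart.\<close>
  have "open (?line -` ?U)"
    by (intro open_vimage chart_image_open[OF c(1)] continuous_intros)
  then have "((\<lambda>h. 2 * kinetic_energy g (chart_inv (tangent_chart A c) (?line h, v c)))
      has_real_derivative (\<Sum>k\<in>UNIV. \<Sum>j\<in>UNIV.
        coefficient_derivative c ?z k j (axis i 1) * v c $ k * v c $ j)) (at 0)"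
    by (rule has_field_derivative_transform_within_open[rotated, where S = "?line -` ?U"])
      (use z metric_form_partial_position[OF coefficients_derivative[OF c(1) z]
            coefficients_symmetric[OF c(1) z]]
        in \<open>auto simp: kinetic_energy_tangent_chart_inv[OF c(1)]\<close>)
  then show ?thesis
    by (simp add: partial_x_def DERIV_imp_deriv
        tangent_chart_def[of A c, THEN arg_cong[of _ _ snd]])
qed

section \<open>Variation of the kinetic energy\<close>

lemma kinetic_energy_variation:
  assumes x: "evolution_curve M A g (kinetic_energy g) Fe J x" and J: "open J" "t \<in> J"
    and c: "c \<in> A" "x t \<in> chart_dom c"
  shows "((\<lambda>s. kinetic_energy g (lift_curve A x s)) has_real_derivative
    1/2 * (\<Sum>i\<in>UNIV. covariant_force A g Fe c i (lift_curve A x t)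
             * velocity A x t c $ i)) (at t)"
proof -
  define N where "N = {s \<in> J. x s \<in> chart_dom c}"
  define q where "q = chart_map c \<circ> x"
  define w where "w s = velocity A x s c" for s
  define D where "D = coefficient_derivative c (q t)"
  have curve: "smooth_curve M A J x"
    using x unfolding evolution_curve_def by blast
  have N: "open N" "t \<in> N"
    using open_curve_in_chart[OF curve J(1) c(1)] J c by (auto simp: N_def)
  have qN: "q s \<in> chart_map c ` chart_dom c" if "s \<in> N" for s
    using that by (auto simp: N_def q_def)
  have q: "(q has_vector_derivative w t) (at t)"
    using curve_has_velocity[OF curve J(2) c] by (simp add: q_def w_def)
  have w_eq: "w s = vector_derivative q (at s)" if "s \<in> N" for s
    using that c by (simp add: w_def velocity_def q_def N_def)
  have "smooth_on N q"
    using curve c by (simp add: smooth_curve_def N_def q_def)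
  then have "(\<lambda>s. vector_derivative q (at s)) differentiable (at t)"
    using N by (rule smooth_on_vector_derivative_differentiable)
  then obtain a where "((\<lambda>s. vector_derivative q (at s)) has_vector_derivative a) (at t)"
    using vector_derivative_works by blast
  then have w: "(w has_vector_derivative a) (at t)"
    by (rule has_vector_derivative_transform_within_open[OF _ N]) (simp add: w_eq)
  have G: "(coefficients c i j has_derivative D i j) (at (q t))" for i j
    unfolding D_def by (rule coefficients_derivative[OF c(1) qN[OF N(2)]])
  have sym: "coefficients c i j (q t) = coefficients c j i (q t)" for i j
    by (rule coefficients_symmetric[OF c(1) qN[OF N(2)]])
  have "((\<lambda>s. 2 * (\<Sum>j\<in>UNIV. coefficients c i j (q s) * w s $ j)) has_real_derivative
      2 * (\<Sum>j\<in>UNIV. D i j (w t) * w t $ j + a $ j * coefficients c i j (q t))) (at t)" for i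
    by (intro DERIV_cmult DERIV_sum DERIV_mult has_real_derivative_along[OF q G]
        has_real_derivative_component[OF w])
  then have "((\<lambda>s. partial_y A c i (\<lambda>z. 2 * kinetic_energy g z) (lift_curve A x s))
      has_real_derivative
      2 * (\<Sum>j\<in>UNIV. D i j (w t) * w t $ j + a $ j * coefficients c i j (q t))) (at t)" for i
    by (rule has_field_derivative_transform_within_open[OF _ N])
      (simp add: lift_curve_def partial_y_kinetic_energy[OF c(1)] N_def q_def w_def)
  then have momentum: "deriv (\<lambda>s. partial_y A c i (\<lambda>z. 2 * kinetic_energy g z) (lift_curve A x s)) t
      = 2 * (\<Sum>j\<in>UNIV. D i j (w t) * w t $ j + coefficients c i j (q t) * a $ j)" for i
    by (simp add: DERIV_imp_deriv mult.commute)
  have force: "covariant_force A g Fe c i (lift_curve A x t)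
      = 2 * (\<Sum>j\<in>UNIV. D i j (w t) * w t $ j + coefficients c i j (q t) * a $ j)
        - (\<Sum>k\<in>UNIV. \<Sum>j\<in>UNIV. D k j (axis i 1) * w t $ k * w t $ j)" for i
  proof -
    have "partial_x A c i (\<lambda>z. 2 * kinetic_energy g z) (lift_curve A x t)
        = (\<Sum>k\<in>UNIV. \<Sum>j\<in>UNIV. D k j (axis i 1) * w t $ k * w t $ j)"
      by (simp add: lift_curve_def partial_x_kinetic_energy[OF c] D_def q_def w_def)
    moreover have "deriv (\<lambda>s. partial_y A c i (\<lambda>z. 2 * kinetic_energy g z) (lift_curve A x s)) t
        - partial_x A c i (\<lambda>z. 2 * kinetic_energy g z) (lift_curve A x t)
        = covariant_force A g Fe c i (lift_curve A x t)"
      using x J(2) c unfolding evolution_curve_def by blast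
    ultimately show ?thesis
      using momentum by simp
  qed
  have "(\<Sum>i\<in>UNIV. covariant_force A g Fe c i (lift_curve A x t) * w t $ i)
      = (\<Sum>i\<in>UNIV. \<Sum>j\<in>UNIV. D i j (w t) * w t $ i * w t $ j)
        + 2 * (\<Sum>i\<in>UNIV. \<Sum>j\<in>UNIV. coefficients c i j (q t) * a $ i * w t $ j)"
    unfolding force by (rule lagrange_contraction[OF has_derivative_linear[OF G] sym])
  then have "((\<lambda>s. metric_form (coefficients c) (q s) (w s)) has_real_derivative
      (\<Sum>i\<in>UNIV. covariant_force A g Fe c i (lift_curve A x t) * w t $ i)) (at t)"
    using metric_form_derivative[OF q w G sym] by simp
  from DERIV_cmult[OF this, of "1/2"] show ?thesis
    unfolding w_def[symmetric]
  proof (rule has_field_derivative_transform_within_open[OF _ N])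
    fix s assume s: "s \<in> N"
    then have "velocity A x s \<in> tangent_space A (x s)"
      by (intro velocity_in_tangent_space[OF curve J(1)]) (simp add: N_def)
    then have "2 * kinetic_energy g (lift_curve A x s) = metric_form (coefficients c) (q s) (w s)"
      using kinetic_energy_in_chart[OF c(1)] s by (simp add: lift_curve_def N_def q_def w_def)
    then show "1/2 * metric_form (coefficients c) (q s) (w s)
        = kinetic_energy g (lift_curve A x s)"
      by simp
  qed
qed

end

theorem theorem1p3p2:
  fixes M :: "'m topology"
    and A :: "('m, real^'n::finite) chart set"
    and g :: "'m \<Rightarrow> ('m, real^'n) tangent \<Rightarrow> ('m, real^'n) tangent \<Rightarrow> real"
    and T :: "'m \<times> ('m, real^'n) tangent \<Rightarrow> real"
    and Fe :: "('m, real^'n) tangent_bundle_field"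
    and J :: "real set"
    and x :: "real \<Rightarrow> 'm"
  assumes "riemannian_mechanical_system M A g T Fe"
    and "is_interval J" and "open J"
    and "evolution_curve M A g T Fe J x"
  shows "\<forall>t\<in>J. \<forall>c\<in>A. x t \<in> chart_dom c \<longrightarrow>
    ((\<lambda>s. T (lift_curve A x s)) has_real_derivative
      1/2 * (\<Sum>i\<in>UNIV. covariant_force A g Fe c i (lift_curve A x t)
               * vector_derivative (chart_map c \<circ> x) (at t) $ i)) (at t)"
proof -
  interpret riemannian_mechanical_system M A g T Fe
    by (rule assms(1))
  have x: "evolution_curve M A g (kinetic_energy g) Fe J x"
    using assms(4) by (subst (asm) T_eq)
  show ?thesis
  proof (intro ballI impI)
    fix t c assume t: "t \<in> J" and c: "c \<in> A" "x t \<in> chart_dom c"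
    then have "velocity A x t c = vector_derivative (chart_map c \<circ> x) (at t)"
      by (simp add: velocity_def)
    then show "((\<lambda>s. T (lift_curve A x s)) has_real_derivative
      1/2 * (\<Sum>i\<in>UNIV. covariant_force A g Fe c i (lift_curve A x t)
               * vector_derivative (chart_map c \<circ> x) (at t) $ i)) (at t)"
      using kinetic_energy_variation[OF x assms(3) t c] by (subst T_eq) simp
  qed
qed

end
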